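(* Let $d\ge 2$, let $m\ge 2d$, and let $\Theta\subseteq\mathbb{T}$ be non-empty. Let $\mathcal{C}\subseteq\mathbb{C}^{d\times m}$ denote the set of all matrices $(g_1,\dots,g_m)\in\mathbb{C}^{d\times m}$ (with columns $g_j\in\mathbb{C}^d$) such that the system $\{g_j\}_{j=1}^m$ does $\Theta$-PR in $\mathbb{C}^d$. 1. If $\Theta$ is finite, then $\mathcal{C}$ contains a non-empty Zariski-open subset of $\mathbb{C}^{d\times m}$. 2. If $\Theta$ is countable, then $\mathcal{C}$ contains a $G_\delta$-set that is dense in the Euclidean topology of $\mathbb{C}^{d\times m}$ and has full Lebesgue measure.
   Context: $\mathbb{T}=\{z\in\mathbb{C}:|z|=1\}$. $\mathbb{C}^d$ carries its standard inner product, linear in the first and conjugate linear in the second argument. $\mathbb{C}^{d\times m}$ is identified with $\mathbb{C}^{dm}$. For $\Theta\subseteq\mathbb{T}$, $\mathbf{G}\subseteq\mathbb{C}^d$ does $\Theta$-PR (in $\mathbb{C}^d$) if for all $f,h\in\mathbb{C}^d$ the following holds: if for every $g\in\mathbf{G}$ there exists $\theta_g\in\Theta$ with $\langle f,g\rangle=\theta_g\langle h,g\rangle$, then $f=\theta h$ for some $\theta\in\Theta$. A subset of $\mathbb{C}^N$ is Zariski-closed if it is the common zero set of a family of complex polynomials in $N$ variables, and Zariski-open if its complement is Zariski-closed. "Full Lebesgue measure" means that the complement has Lebesgue measure zero. A $G_\delta$-set is a countable intersection of Euclidean-open sets. *)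

theory Defs
  imports "HOL-Analysis.Analysis" "HOL-Library.Poly_Mapping"
begin

text \<open>The class instance of \<open>inner\<close> on complex vectors is the real inner product, i.e. the real
  part of the following sesquilinear form.\<close>

definition hermitian_inner :: "complex ^ 'd \<Rightarrow> complex ^ 'd \<Rightarrow> complex"
  where "hermitian_inner f g = (\<Sum>i\<in>UNIV. f $ i * cnj (g $ i))"

definition does_PR :: "complex set \<Rightarrow> (complex ^ 'd) set \<Rightarrow> bool"
  where "does_PR \<Theta> G \<longleftrightarrow>
    (\<forall>f h. (\<forall>g\<in>G. \<exists>\<theta>\<in>\<Theta>. hermitian_inner f g = \<theta> * hermitian_inner h g)
            \<longrightarrow> (\<exists>\<theta>\<in>\<Theta>. f = \<theta> *s h))"

text \<open>A complex polynomial in variables indexed by \<open>'n\<close> is a finitely supported map from monomials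
  (exponent vectors) to coefficients.\<close>

type_synonym 'n cpoly = "('n \<Rightarrow>\<^sub>0 nat) \<Rightarrow>\<^sub>0 complex"

definition eval_cpoly :: "'n cpoly \<Rightarrow> complex ^ 'n \<Rightarrow> complex"
  where "eval_cpoly p x =
    (\<Sum>t\<in>Poly_Mapping.keys p. Poly_Mapping.lookup p t * (\<Prod>i\<in>UNIV. x $ i ^ Poly_Mapping.lookup t i))"

definition zariski_closed :: "(complex ^ 'n) set \<Rightarrow> bool"
  where "zariski_closed S \<longleftrightarrow> (\<exists>P :: 'n cpoly set. S = {x. \<forall>p\<in>P. eval_cpoly p x = 0})"

definition zariski_open :: "(complex ^ 'n) set \<Rightarrow> bool"
  where "zariski_open S \<longleftrightarrow> zariski_closed (- S)"

text \<open>The identification of matrices with \<open>d\<close> rows and \<open>m\<close> columns with vectors of length \<open>d m\<close>,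
  whose coordinates are indexed by the pairs (row, column).\<close>

definition vec_of_matrix :: "complex ^ 'm ^ 'd \<Rightarrow> complex ^ ('d \<times> 'm)"
  where "vec_of_matrix A = (\<chi> ij. A $ fst ij $ snd ij)"

definition PR_matrices :: "complex set \<Rightarrow> (complex ^ 'm ^ 'd) set"
  where "PR_matrices \<Theta> = {A. does_PR \<Theta> (range (\<lambda>j. column j A))}"

end

theory Submission
  imports Defs "HOL-Computational_Algebra.Polynomial"
begin

text \<open>
  For a choice of phases \<open>\<sigma> j \<in> \<Theta>\<close> the conditions \<open>\<langle>f - \<sigma> j h, g j\<rangle> = 0\<close> are linear in \<open>(f, h)\<close> and,
  after conjugation, polynomial in the matrix \<open>(g j)\<close>. If \<open>\<sigma>\<close> takes some value \<open>\<theta>\<close> on \<open>d\<close> indices,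
  then the \<open>d \<times> d\<close> minor on these columns being non-zero forces \<open>f = \<theta> h\<close>. Otherwise there are \<open>d\<close>
  disjoint pairs of indices with different phases. The \<open>2d \<times> 2d\<close> determinant on these rows is not
  the zero polynomial, because it does not vanish when both columns of the \<open>i\<close>-th pair are the
  \<open>i\<close>-th unit vector, and where it is non-zero it forces \<open>f = h = 0\<close>. Intersecting the non-vanishing
  sets over all \<open>\<sigma>\<close> gives both claims, since zero sets of non-zero polynomials are null sets.
\<close>

section \<open>Polynomial functions and their closure properties\<close>

lemma eval_cpoly_superset:
  assumes "finite S" "Poly_Mapping.keys p \<subseteq> S"
  shows "eval_cpoly p x =
    (\<Sum>t\<in>S. Poly_Mapping.lookup p t * (\<Prod>i\<in>UNIV. x $ i ^ Poly_Mapping.lookup t i))"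
  unfolding eval_cpoly_def
  by (rule sum.mono_neutral_left) (use assms in \<open>auto simp: in_keys_iff\<close>)

lemma eval_cpoly_add: "eval_cpoly (p + q) x = eval_cpoly p x + eval_cpoly q x"
proof -
  let ?S = "Poly_Mapping.keys p \<union> Poly_Mapping.keys q"
  have "Poly_Mapping.keys (p + q) \<subseteq> ?S"
    by (rule keys_add)
  then show ?thesis
    by (subst (1 2 3) eval_cpoly_superset[of ?S])
      (auto simp: lookup_add distrib_right sum.distrib)
qed

text \<open>Polynomial functions are treated as members of the range of \<open>eval_cpoly\<close>.
  Monomials are the building blocks; closure under sums and products then yields constants,
  coordinates and determinants without computing coefficients.\<close>

lemma monomial_in_range_eval_cpoly:
  "(\<lambda>x. c * (\<Prod>i\<in>UNIV. x $ i ^ k i)) \<in> range (eval_cpoly :: 'n::finite cpoly \<Rightarrow> _)"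
proof (rule range_eqI)
  have "finite {i. k i \<noteq> 0}"
    by simp
  then have "Poly_Mapping.lookup (Abs_poly_mapping k) = k"
    by (simp add: Abs_poly_mapping_inverse)
  then show "(\<lambda>x. c * (\<Prod>i\<in>UNIV. x $ i ^ k i)) =
      eval_cpoly (Poly_Mapping.single (Abs_poly_mapping k) c)"
    by (simp add: fun_eq_iff eval_cpoly_superset[of "{Abs_poly_mapping k}"])
qed

lemma const_in_range_eval_cpoly:
  "(\<lambda>x. c) \<in> range (eval_cpoly :: 'n::finite cpoly \<Rightarrow> _)"
  using monomial_in_range_eval_cpoly[of c "\<lambda>_. 0"] by simp

lemma coordinate_in_range_eval_cpoly:
  "(\<lambda>x. x $ i) \<in> range (eval_cpoly :: 'n::finite cpoly \<Rightarrow> _)"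
proof -
  have "(\<Prod>j\<in>UNIV. x $ j ^ (if j = i then 1 else 0)) = x $ i" for x :: "complex ^ 'n"
    by (simp add: if_distrib[of "\<lambda>k. _ ^ k"] prod.delta cong: if_cong)
  then show ?thesis
    using monomial_in_range_eval_cpoly[of 1 "\<lambda>j. if j = i then 1 else 0"] by simp
qed

lemma sum_in_range_eval_cpoly:
  assumes "\<And>s. s \<in> S \<Longrightarrow> F s \<in> range (eval_cpoly :: 'n::finite cpoly \<Rightarrow> _)"
  shows "(\<lambda>x. \<Sum>s\<in>S. F s x) \<in> range (eval_cpoly :: 'n cpoly \<Rightarrow> _)"
  using assms
proof (induction S rule: infinite_finite_induct)
  case (insert s S)
  then have "F s \<in> range eval_cpoly" "(\<lambda>x. \<Sum>s\<in>S. F s x) \<in> range eval_cpoly"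
    by auto
  then obtain p q where "F s = eval_cpoly p" "(\<lambda>x. \<Sum>s\<in>S. F s x) = eval_cpoly q"
    by (elim rangeE)
  then have "(\<lambda>x. \<Sum>s\<in>insert s S. F s x) = eval_cpoly (p + q)"
    using insert.hyps by (simp add: fun_eq_iff eval_cpoly_add)
  then show ?case
    by (rule range_eqI)
qed (simp_all add: const_in_range_eval_cpoly)

text \<open>The product of two evaluations expands into a double sum of monomials with added
  exponents, so the multiplication of \<open>cpoly\<close> itself never enters.\<close>

lemma mult_in_range_eval_cpoly:
  assumes "F \<in> range (eval_cpoly :: 'n::finite cpoly \<Rightarrow> _)" "G \<in> range (eval_cpoly :: 'n cpoly \<Rightarrow> _)"
  shows "(\<lambda>x. F x * G x) \<in> range (eval_cpoly :: 'n cpoly \<Rightarrow> _)"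
proof -
  obtain p q :: "'n cpoly" where pq: "F = eval_cpoly p" "G = eval_cpoly q"
    using assms by blast
  let ?c = "\<lambda>s t. Poly_Mapping.lookup p s * Poly_Mapping.lookup q t"
  let ?e = "\<lambda>s t i. Poly_Mapping.lookup s i + Poly_Mapping.lookup t i"
  have "(\<lambda>x. F x * G x) = (\<lambda>x. \<Sum>s\<in>Poly_Mapping.keys p. \<Sum>t\<in>Poly_Mapping.keys q.
      ?c s t * (\<Prod>i\<in>UNIV. x $ i ^ ?e s t i))"
    by (simp add: pq eval_cpoly_def sum_product power_add prod.distrib mult_ac)
  then show ?thesis
    by (simp only:) (intro sum_in_range_eval_cpoly monomial_in_range_eval_cpoly)
qed

lemma prod_in_range_eval_cpoly:
  assumes "\<And>s. s \<in> S \<Longrightarrow> F s \<in> range (eval_cpoly :: 'n::finite cpoly \<Rightarrow> _)"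
  shows "(\<lambda>x. \<Prod>s\<in>S. F s x) \<in> range (eval_cpoly :: 'n cpoly \<Rightarrow> _)"
  using assms
  by (induction S rule: infinite_finite_induct)
    (auto intro: const_in_range_eval_cpoly mult_in_range_eval_cpoly)

text \<open>The Leibniz formula builds the determinant from sums and products. Entries that are a
  scalar times a coordinate cover both families of matrices used as certificates.\<close>

lemma det_in_range_eval_cpoly:
  "(\<lambda>x. det (\<chi> s t. c s t * x $ k s t :: complex ^ 's ^ 's))
     \<in> range (eval_cpoly :: 'n::finite cpoly \<Rightarrow> _)"
  unfolding det_def vec_lambda_beta
  by (intro sum_in_range_eval_cpoly mult_in_range_eval_cpoly prod_in_range_eval_cpoly
      const_in_range_eval_cpoly coordinate_in_range_eval_cpoly)

section \<open>Zero sets of non-zero polynomials are null sets\<close>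

lemma continuous_on_eval_cpoly: "continuous_on S (eval_cpoly p)"
  unfolding eval_cpoly_def by (intro continuous_intros)

text \<open>Each coordinate of \<open>a + t *s x\<close> is affine in \<open>t\<close>, namely the
  value of \<open>[:a $ i, x $ i:]\<close> at \<open>t\<close>.\<close>

lemma eval_cpoly_on_line:
  "\<exists>q :: complex poly. \<forall>t. eval_cpoly p (a + t *s x) = poly q t"
proof -
  let ?q = "\<Sum>s\<in>Poly_Mapping.keys p. Polynomial.smult (Poly_Mapping.lookup p s)
      (\<Prod>i\<in>UNIV. [:a $ i, x $ i:] ^ Poly_Mapping.lookup s i)"
  have "\<forall>t. eval_cpoly p (a + t *s x) = poly ?q t"
    by (simp add: eval_cpoly_def poly_sum poly_prod)
  then show ?thesis ..
qed

text \<open>Each line through \<open>a\<close> meets the zero set in finitely many points, so by Fubini almost every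
  homothety with centre \<open>a\<close> pulls the zero set back to a null set.\<close>

lemma negligible_zeros_of_polynomial_on_lines:
  fixes F :: "'a::euclidean_space \<Rightarrow> complex"
  assumes cont: "continuous_on UNIV F" and "F a \<noteq> 0"
    and line: "\<And>x. \<exists>q. \<forall>t. F (a + t *\<^sub>R x) = poly q (complex_of_real t)"
  shows "negligible {x. F x = 0}"
proof -
  have fin: "finite {t. F (a + t *\<^sub>R x) = 0}" for x
  proof -
    obtain q where q: "\<And>t. F (a + t *\<^sub>R x) = poly q (complex_of_real t)"
      using line by blast
    from q[of 0] \<open>F a \<noteq> 0\<close> have "q \<noteq> 0"
      by auto
    then have "finite (complex_of_real -` {z. poly q z = 0})"
      by (intro finite_vimageI poly_roots_finite) (auto simp: inj_on_def)
    then show ?thesis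
      by (simp add: q vimage_def)
  qed
  have "AE t in lborel. F (a + t *\<^sub>R x) \<noteq> 0" for x
    using AE_not_in[OF finite_imp_null_set_lborel[OF fin[of x]]] by simp
  then have "AE x in lborel. AE t in lborel. F (a + t *\<^sub>R x) \<noteq> 0"
    by simp
  moreover have "pair_sigma_finite (lborel :: 'a measure) (lborel :: real measure)"
    by unfold_locales
  moreover have "{z \<in> space (lborel \<Otimes>\<^sub>M lborel). F (a + snd z *\<^sub>R fst z) \<noteq> 0}
      \<in> sets ((lborel :: 'a measure) \<Otimes>\<^sub>M (lborel :: real measure))"
  proof -
    have "open {z :: 'a \<times> real. F (a + snd z *\<^sub>R fst z) \<noteq> 0}"
      by (intro open_Collect_neq continuous_on_compose2[OF cont] continuous_intros) auto
    then show ?thesis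
      unfolding lborel_prod by (simp add: space_pair_measure)
  qed
  ultimately have "AE t in lborel. AE x in lborel. F (a + t *\<^sub>R x) \<noteq> 0"
    by (simp add: pair_sigma_finite.AE_commute[where P = "\<lambda>x t. F (a + t *\<^sub>R x) \<noteq> 0"])
  \<comment> \<open>The parameter \<open>t = 0\<close> is discarded because the homothety has to be
    invertible: only then does it carry the pulled back null set onto the whole zero set of
    \<open>F\<close>.\<close>
  then have "AE t in lborel. t \<noteq> (0::real) \<and> (AE x in lborel. F (a + t *\<^sub>R x) \<noteq> 0)"
    using AE_lborel_singleton[of "0::real"] by eventually_elim simp
  moreover have "ae_filter (lborel :: real measure) \<noteq> bot"
    by (simp add: ae_filter_eq_bot_iff)
  ultimately obtain t :: real where "t \<noteq> 0" and ae: "AE x in lborel. F (a + t *\<^sub>R x) \<noteq> 0"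
    using eventually_happens' by blast
  from AE_completion[OF ae]
  obtain N where "N \<in> null_sets lebesgue" "{x. F (a + t *\<^sub>R x) = 0} \<subseteq> N"
    by (auto simp: eventually_ae_filter)
  then have "negligible {x. F (a + t *\<^sub>R x) = 0}"
    using negligible_iff_null_sets negligible_subset by blast
  then have "negligible ((\<lambda>x. a + t *\<^sub>R x) ` {x. F (a + t *\<^sub>R x) = 0})"
    by (intro negligible_differentiable_image_negligible)
      (auto intro!: derivative_intros simp: differentiable_on_def)
  also have "(\<lambda>x. a + t *\<^sub>R x) ` {x. F (a + t *\<^sub>R x) = 0} = {x. F x = 0}"
  proof (intro equalityI subsetI)
    fix x assume "x \<in> {x. F x = 0}"
    then show "x \<in> (\<lambda>x. a + t *\<^sub>R x) ` {x. F (a + t *\<^sub>R x) = 0}"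
      using \<open>t \<noteq> 0\<close> by (intro image_eqI[of _ _ "(x - a) /\<^sub>R t"]) auto
  qed auto
  finally show ?thesis .
qed

lemma continuous_on_vec_of_matrix: "continuous_on S vec_of_matrix"
  unfolding vec_of_matrix_def by (intro continuous_intros)

lemma negligible_zeros_eval_cpoly_matrix:
  fixes p :: "('d::finite \<times> 'm::finite) cpoly" and A :: "complex ^ 'm ^ 'd"
  assumes "eval_cpoly p (vec_of_matrix A) \<noteq> 0"
  shows "negligible {A :: complex ^ 'm ^ 'd. eval_cpoly p (vec_of_matrix A) = 0}"
proof (rule negligible_zeros_of_polynomial_on_lines[where a = A])
  show "continuous_on UNIV (\<lambda>A :: complex ^ 'm ^ 'd. eval_cpoly p (vec_of_matrix A))"
    by (rule continuous_on_compose2[OF continuous_on_eval_cpoly continuous_on_vec_of_matrix]) auto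
  show "eval_cpoly p (vec_of_matrix A) \<noteq> 0"
    by (rule assms)
  fix X :: "complex ^ 'm ^ 'd"
  \<comment> \<open>Lebesgue measure lives on the underlying real vector space, so the lines have a
    real parameter, which is read here as a complex one.\<close>
  have "vec_of_matrix (A + t *\<^sub>R X) = vec_of_matrix A + complex_of_real t *s vec_of_matrix X" for t
    by (simp add: vec_of_matrix_def vec_eq_iff scaleR_conv_of_real[where 'a=complex])
  then show "\<exists>q. \<forall>t. eval_cpoly p (vec_of_matrix (A + t *\<^sub>R X)) = poly q (complex_of_real t)"
    using eval_cpoly_on_line[of p "vec_of_matrix A" "vec_of_matrix X"] by metis
qed

section \<open>Colourings of the index set\<close>

text \<open>Sort the indices by colour and compare positions \<open>i\<close> and \<open>i + d\<close>: if their colours agree,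
  then so do the colours of all positions in between.\<close>

lemma monochromatic_set_or_bichromatic_pairs:
  fixes \<sigma> :: "'m::finite \<Rightarrow> 'a"
  assumes "2 * CARD('d::finite) \<le> CARD('m)"
  obtains (mono) r :: "'d::finite \<Rightarrow> 'm" and \<theta> where "inj r" "\<And>i. \<sigma> (r i) = \<theta>"
  | (pairs) r :: "'d::finite + 'd \<Rightarrow> 'm" where "inj r" "\<And>i. \<sigma> (r (Inl i)) \<noteq> \<sigma> (r (Inr i))"
proof -
  let ?d = "CARD('d)"
  \<comment> \<open>Colours carry no order. Only finitely many occur, so they can be numbered
    injectively, which makes sorting possible.\<close>
  obtain k :: "'a \<Rightarrow> nat" where k: "inj_on k (range \<sigma>)"
    using finite_imp_inj_to_nat_seg[of "range \<sigma>"] by auto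
  obtain xs0 :: "'m list" where xs0: "set xs0 = UNIV" "distinct xs0"
    using finite_distinct_list[of "UNIV :: 'm set"] by auto
  define xs where "xs = sort_key (k \<circ> \<sigma>) xs0"
  have "distinct xs" "sorted (map (k \<circ> \<sigma>) xs)" "set xs = UNIV"
    using xs0 by (simp_all add: xs_def)
  then have len: "2 * ?d \<le> length xs"
    using assms distinct_card[of xs] by simp
  have sorted: "k (\<sigma> (xs ! i)) \<le> k (\<sigma> (xs ! j))" if "i \<le> j" "j < length xs" for i j
    using sorted_nth_mono[OF \<open>sorted (map (k \<circ> \<sigma>) xs)\<close>, of i j] that by simp
  obtain e :: "'d \<Rightarrow> nat" where e: "bij_betw e UNIV {0..<?d}"
    using ex_bij_betw_finite_nat[of "UNIV :: 'd set"] by auto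
  then have "inj e" and e_less: "e i < ?d" for i
    using bij_betw_apply[OF e, of i] by (auto simp: bij_betw_def)
  have inj_nth: "xs ! i = xs ! j \<longleftrightarrow> i = j" if "i < 2 * ?d" "j < 2 * ?d" for i j
    using nth_eq_iff_index_eq[OF \<open>distinct xs\<close>] that len by auto
  have e_eq: "e i = e j \<longleftrightarrow> i = j" for i j
    using \<open>inj e\<close> by (auto dest: injD)
  show thesis
  proof (cases "\<exists>i<?d. \<sigma> (xs ! i) = \<sigma> (xs ! (i + ?d))")
    case True
    then obtain i where i: "i < ?d" "\<sigma> (xs ! i) = \<sigma> (xs ! (i + ?d))"
      by blast
    show thesis
    proof (rule mono[of "\<lambda>s. xs ! (i + e s)" "\<sigma> (xs ! i)"])
      show "inj (\<lambda>s. xs ! (i + e s))"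
      proof (rule injI)
        fix s t assume "xs ! (i + e s) = xs ! (i + e t)"
        then show "s = t"
          using inj_nth[of "i + e s" "i + e t"] e_less[of s] e_less[of t] i by (auto simp: e_eq)
      qed
      fix s
      have "k (\<sigma> (xs ! i)) \<le> k (\<sigma> (xs ! (i + e s)))"
           "k (\<sigma> (xs ! (i + e s))) \<le> k (\<sigma> (xs ! (i + ?d)))"
        using sorted[of i "i + e s"] sorted[of "i + e s" "i + ?d"] e_less[of s] i len by auto
      then show "\<sigma> (xs ! (i + e s)) = \<sigma> (xs ! i)"
        using i k by (auto dest: inj_onD)
    qed
  next
    case False
    show thesis
    proof (rule pairs[of "case_sum (\<lambda>s. xs ! e s) (\<lambda>s. xs ! (e s + ?d))"])
      show "inj (case_sum (\<lambda>s. xs ! e s) (\<lambda>s. xs ! (e s + ?d)))"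
      proof (rule injI)
        fix s t :: "'d + 'd"
        \<comment> \<open>\<open>Inl\<close> occupies the first block of \<open>?d\<close> positions
          and \<open>Inr\<close> the second, so the two blocks are disjoint.\<close>
        let ?pos = "case_sum e (\<lambda>i. e i + ?d)"
        assume "case_sum (\<lambda>s. xs ! e s) (\<lambda>s. xs ! (e s + ?d)) s =
          case_sum (\<lambda>s. xs ! e s) (\<lambda>s. xs ! (e s + ?d)) t"
        then have "xs ! ?pos s = xs ! ?pos t"
          by (simp split: sum.splits)
        moreover have "?pos u < 2 * ?d" for u
        proof (cases u)
          case (Inl i)
          then show ?thesis using e_less[of i] by simp
        next
          case (Inr i)
          then show ?thesis using e_less[of i] by simp
        qed
        ultimately have "?pos s = ?pos t"
          using inj_nth by blast
        moreover have "e i \<noteq> e j + ?d" for i j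
          using e_less[of i] by linarith
        ultimately show "s = t"
          using e_eq by (cases s; cases t) (simp_all, metis)
      qed
    qed (use False e_less in auto)
  qed
qed

section \<open>Determinants as certificates for a fixed choice of phases\<close>

lemma det_nonzero_iff_trivial_kernel:
  fixes M :: "'a::field ^ 'n ^ 'n"
  shows "det M \<noteq> 0 \<longleftrightarrow> (\<forall>x. M *v x = 0 \<longrightarrow> x = 0)"
  by (simp flip: invertible_det_nz matrix_left_invertible_ker add: invertible_left_inverse)

text \<open>Conjugation moves from \<open>g\<close> to \<open>f\<close>, so that the entries of the
  matrix enter the conditions holomorphically, as a complex polynomial requires.\<close>

lemma cnj_hermitian_inner: "cnj (hermitian_inner f g) = (\<Sum>i\<in>UNIV. cnj (f $ i) * g $ i)"
  by (simp add: hermitian_inner_def)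

lemma det_eq_eval_cpoly_matrix:
  obtains p :: "('d::finite \<times> 'm::finite) cpoly"
  where "\<And>A. eval_cpoly p (vec_of_matrix A) =
    det (\<chi> s t. c s t * A $ k s t $ l s t :: complex ^ 's ^ 's)"
proof -
  obtain p :: "('d \<times> 'm) cpoly"
    where "(\<lambda>x. det (\<chi> s t. c s t * x $ (k s t, l s t) :: complex ^ 's ^ 's)) = eval_cpoly p"
    using det_in_range_eval_cpoly[of c "\<lambda>s t. (k s t, l s t)"] by (elim rangeE)
  from this[symmetric] show thesis
    by (intro that[of p]) (simp add: vec_of_matrix_def)
qed

lemma polynomial_certificate_mono:
  fixes r :: "'d::finite \<Rightarrow> 'm::finite"
  assumes "inj r" "\<And>i. \<sigma> (r i) = \<theta>"
  obtains p :: "('d \<times> 'm) cpoly" and B :: "complex ^ 'm ^ 'd"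
  where "eval_cpoly p (vec_of_matrix B) \<noteq> 0"
    and "\<And>A f h. eval_cpoly p (vec_of_matrix A) \<noteq> 0 \<Longrightarrow>
      (\<And>j. hermitian_inner f (column j A) = \<sigma> j * hermitian_inner h (column j A)) \<Longrightarrow> f = \<theta> *s h"
proof -
  define M :: "complex ^ 'm ^ 'd \<Rightarrow> complex ^ 'd ^ 'd" where "M A = (\<chi> s i. A $ i $ r s)" for A
  obtain p :: "('d \<times> 'm) cpoly" where p: "eval_cpoly p (vec_of_matrix A) = det (M A)" for A
    using det_eq_eval_cpoly_matrix[of "\<lambda>_ _. 1" "\<lambda>s i. i" "\<lambda>s i. r s"]
    by (auto simp: M_def)
  \<comment> \<open>The selected columns are the unit vectors; injectivity of \<open>r\<close> makes
    this consistent.\<close>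
  define B :: "complex ^ 'm ^ 'd" where "B = (\<chi> i j. if j = r i then 1 else 0)"
  have "M B = mat 1"
    using \<open>inj r\<close> by (auto simp: M_def B_def mat_def vec_eq_iff dest: injD)
  show thesis
  proof (rule that)
    show "eval_cpoly p (vec_of_matrix B) \<noteq> 0"
      by (simp add: p \<open>M B = mat 1\<close>)
    fix A f h
    assume nz: "eval_cpoly p (vec_of_matrix A) \<noteq> 0"
      and eq: "\<And>j. hermitian_inner f (column j A) = \<sigma> j * hermitian_inner h (column j A)"
    have "M A *v (\<chi> i. cnj (f $ i - \<theta> * h $ i)) = 0"
    proof -
      have "(M A *v (\<chi> i. cnj (f $ i - \<theta> * h $ i))) $ s =
        cnj (hermitian_inner f (column (r s) A) - \<theta> * hermitian_inner h (column (r s) A))" for s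
        by (simp add: M_def matrix_vector_mult_def cnj_hermitian_inner column_def
            algebra_simps sum_distrib_left sum_subtractf)
      then show ?thesis
        by (simp add: vec_eq_iff eq assms)
    qed
    then have "(\<chi> i. cnj (f $ i - \<theta> * h $ i)) = 0"
      using nz by (simp add: p det_nonzero_iff_trivial_kernel)
    \<comment> \<open>Keeping \<open>cnj\<close> outside the difference lets the simplifier cancel
      it.\<close>
    then show "f = \<theta> *s h"
      by (simp add: vec_eq_iff del: complex_cnj_diff complex_cnj_mult)
  qed
qed

lemma polynomial_certificate_pairs:
  fixes r :: "'d::finite + 'd \<Rightarrow> 'm::finite"
  assumes "inj r" "\<And>i. \<sigma> (r (Inl i)) \<noteq> \<sigma> (r (Inr i))"
  obtains p :: "('d \<times> 'm) cpoly" and B :: "complex ^ 'm ^ 'd"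
  where "eval_cpoly p (vec_of_matrix B) \<noteq> 0"
    and "\<And>A f h. eval_cpoly p (vec_of_matrix A) \<noteq> 0 \<Longrightarrow>
      (\<And>j. hermitian_inner f (column j A) = \<sigma> j * hermitian_inner h (column j A)) \<Longrightarrow>
      f = 0 \<and> h = 0"
proof -
  \<comment> \<open>Row \<open>s\<close> encodes the conjugate of the condition at index
    \<open>r s\<close>. The \<open>Inl\<close> unknowns stand for the conjugate of \<open>f\<close>,
    the \<open>Inr\<close> unknowns for that of \<open>h\<close>.\<close>
  define c :: "'d + 'd \<Rightarrow> 'd + 'd \<Rightarrow> complex"
    where "c s t = case_sum (\<lambda>_. 1) (\<lambda>_. - cnj (\<sigma> (r s))) t" for s t
  define M :: "complex ^ 'm ^ 'd \<Rightarrow> complex ^ ('d + 'd) ^ ('d + 'd)"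
    where "M A = (\<chi> s t. c s t * A $ case_sum id id t $ r s)" for A
  obtain p :: "('d \<times> 'm) cpoly" where p: "eval_cpoly p (vec_of_matrix A) = det (M A)" for A
    using det_eq_eval_cpoly_matrix[of c "\<lambda>s. case_sum id id" "\<lambda>s t. r s"]
    unfolding M_def by blast
  have M_mult: "(M A *v v) $ s = (\<Sum>i\<in>UNIV. v $ Inl i * A $ i $ r s)
      - cnj (\<sigma> (r s)) * (\<Sum>i\<in>UNIV. v $ Inr i * A $ i $ r s)" for A v s
    by (simp add: matrix_vector_mult_def M_def c_def sum.Plus sum_distrib_left sum_negf mult_ac
        flip: UNIV_Plus_UNIV)
  \<comment> \<open>With this choice the system splits into one 2 by 2 system per pair, whose
    determinant is a difference of conjugated phases.\<close>
  define B :: "complex ^ 'm ^ 'd"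
    where "B = (\<chi> i j. if j = r (Inl i) \<or> j = r (Inr i) then 1 else 0)"
  have "v = 0" if "M B *v v = 0" for v
  proof -
    have B: "B $ i' $ r (Inl i) = (if i' = i then 1 else 0)"
            "B $ i' $ r (Inr i) = (if i' = i then 1 else 0)" for i i'
      using \<open>inj r\<close> by (auto simp: B_def dest: injD)
    have l: "v $ Inl i - cnj (\<sigma> (r (Inl i))) * v $ Inr i = 0"
      and r: "v $ Inl i - cnj (\<sigma> (r (Inr i))) * v $ Inr i = 0" for i
      using that M_mult[of B v "Inl i"] M_mult[of B v "Inr i"]
      by (simp_all add: B if_distrib cong: if_cong)
    \<comment> \<open>Subtracting \<open>l\<close> and \<open>r\<close> leaves
      \<open>v $ Inr i\<close> times a non-zero difference of phases.\<close>
    have inr: "v $ Inr i = 0" for i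
      using l[of i] r[of i] assms(2)[of i] by auto
    then have "v $ s = 0" for s
      using l by (cases s) auto
    then show ?thesis
      by (simp add: vec_eq_iff)
  qed
  then have "det (M B) \<noteq> 0"
    by (simp add: det_nonzero_iff_trivial_kernel)
  show thesis
  proof (rule that)
    show "eval_cpoly p (vec_of_matrix B) \<noteq> 0"
      by (simp add: p \<open>det (M B) \<noteq> 0\<close>)
    fix A f h
    assume nz: "eval_cpoly p (vec_of_matrix A) \<noteq> 0"
      and eq: "\<And>j. hermitian_inner f (column j A) = \<sigma> j * hermitian_inner h (column j A)"
    define v :: "complex ^ ('d + 'd)"
      where "v = (\<chi> t. case_sum (\<lambda>i. cnj (f $ i)) (\<lambda>i. cnj (h $ i)) t)"
    have "(M A *v v) $ s =
      cnj (hermitian_inner f (column (r s) A) - \<sigma> (r s) * hermitian_inner h (column (r s) A))" for s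
      by (simp add: M_mult v_def cnj_hermitian_inner column_def)
    then have "M A *v v = 0"
      by (simp add: vec_eq_iff eq)
    then have "v = 0"
      using nz by (simp add: p det_nonzero_iff_trivial_kernel)
    then have "v $ Inl i = 0" "v $ Inr i = 0" for i
      by simp_all
    then show "f = 0 \<and> h = 0"
      by (simp add: v_def vec_eq_iff)
  qed
qed

text \<open>Both cases are merged into one conclusion. Since \<theta> is a value of \<sigma>, it
  lies in \<Theta> as soon as \<sigma> takes its values there.\<close>

lemma polynomial_certificate:
  fixes \<sigma> :: "'m::finite \<Rightarrow> complex"
  assumes "2 * CARD('d::finite) \<le> CARD('m)"
  shows "\<exists>p :: ('d \<times> 'm) cpoly.
    (\<exists>B :: complex ^ 'm ^ 'd. eval_cpoly p (vec_of_matrix B) \<noteq> 0) \<and>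
    (\<forall>A f h. eval_cpoly p (vec_of_matrix A) \<noteq> 0 \<longrightarrow>
      (\<forall>j. hermitian_inner f (column j A) = \<sigma> j * hermitian_inner h (column j A)) \<longrightarrow>
      (\<exists>\<theta>\<in>range \<sigma>. f = \<theta> *s h))"
  using assms
proof (cases rule: monochromatic_set_or_bichromatic_pairs[of \<sigma>])
  case (mono r \<theta>)
  then have "\<theta> \<in> range \<sigma>"
    by (metis rangeI)
  show ?thesis
    using polynomial_certificate_mono[where r = r and \<sigma> = \<sigma> and \<theta> = \<theta>] mono \<open>\<theta> \<in> range \<sigma>\<close>
    by metis
next
  case (pairs r)
  \<comment> \<open>For \<open>f = h = 0\<close> every phase works;
    \<open>\<sigma> undefined\<close> is merely some value of \<sigma>.\<close>
  have zero: "f = \<sigma> undefined *s h" if "f = 0 \<and> h = 0" for f h :: "complex ^ 'd"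
    using that by simp
  show ?thesis
    using polynomial_certificate_pairs[where r = r and \<sigma> = \<sigma>] pairs zero rangeI
    by metis
qed

section \<open>Intersection over all choices of phases\<close>

theorem theorem1p9:
  fixes \<Theta> :: "complex set"
  assumes "2 \<le> CARD('d::finite)"
    and "2 * CARD('d) \<le> CARD('m::finite)"
    and "\<Theta> \<subseteq> {z. cmod z = 1}" and "\<Theta> \<noteq> {}"
  shows "(finite \<Theta> \<longrightarrow>
            (\<exists>U :: (complex ^ 'm ^ 'd) set.
               zariski_open (vec_of_matrix ` U) \<and> U \<noteq> {} \<and> U \<subseteq> PR_matrices \<Theta>)) \<and>
         (countable \<Theta> \<longrightarrow>
            (\<exists>G :: (complex ^ 'm ^ 'd) set.
               gdelta_in euclidean G \<and> closure G = UNIV \<and> - G \<in> null_sets lebesgue \<and>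
               G \<subseteq> PR_matrices \<Theta>))"
proof -
  \<comment> \<open>There are finitely many indices, so the set of phase choices inherits finiteness
    or countability from \<Theta>.\<close>
  define \<Sigma> :: "('m \<Rightarrow> complex) set" where "\<Sigma> = (\<Pi>\<^sub>E j\<in>UNIV. \<Theta>)"
  from choice[OF allI[OF polynomial_certificate[OF assms(2)]]]
  obtain P :: "('m \<Rightarrow> complex) \<Rightarrow> ('d \<times> 'm) cpoly"
    where cert: "\<forall>\<sigma>. (\<exists>B :: complex ^ 'm ^ 'd. eval_cpoly (P \<sigma>) (vec_of_matrix B) \<noteq> 0) \<and>
      (\<forall>A f h. eval_cpoly (P \<sigma>) (vec_of_matrix A) \<noteq> 0 \<longrightarrow>
        (\<forall>j. hermitian_inner f (column j A) = \<sigma> j * hermitian_inner h (column j A)) \<longrightarrow>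
        (\<exists>\<theta>\<in>range \<sigma>. f = \<theta> *s h))"
    by (rule exE)
  \<comment> \<open>One set serves as witness for both claims.\<close>
  define G :: "(complex ^ 'm ^ 'd) set"
    where "G = {A. \<forall>\<sigma>\<in>\<Sigma>. eval_cpoly (P \<sigma>) (vec_of_matrix A) \<noteq> 0}"
  have "A \<in> PR_matrices \<Theta>" if "A \<in> G" for A
    unfolding PR_matrices_def does_PR_def
  proof safe
    fix f h
    assume "\<forall>g\<in>range (\<lambda>j. column j A). \<exists>\<theta>\<in>\<Theta>. hermitian_inner f g = \<theta> * hermitian_inner h g"
    then have "\<forall>j. \<exists>\<theta>. \<theta> \<in> \<Theta> \<and> hermitian_inner f (column j A) = \<theta> * hermitian_inner h (column j A)"
      by blast
    from choice[OF this] obtain \<sigma> where \<sigma>: "\<forall>j. \<sigma> j \<in> \<Theta> \<and>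
        hermitian_inner f (column j A) = \<sigma> j * hermitian_inner h (column j A)"
      by (rule exE)
    then have "eval_cpoly (P \<sigma>) (vec_of_matrix A) \<noteq> 0"
      using that by (auto simp: G_def \<Sigma>_def)
    then show "\<exists>\<theta>\<in>\<Theta>. f = \<theta> *s h"
      using cert \<sigma> by blast
  qed
  then have G_PR: "G \<subseteq> PR_matrices \<Theta>"
    by blast
  have compl_G: "- G = (\<Union>\<sigma>\<in>\<Sigma>. {A. eval_cpoly (P \<sigma>) (vec_of_matrix A) = 0})"
    by (auto simp: G_def)
  have G_null: "- G \<in> null_sets lebesgue" if "countable \<Theta>"
  proof -
    have "countable \<Sigma>"
      using that by (simp add: \<Sigma>_def countable_PiE)
    moreover have "negligible {A :: complex ^ 'm ^ 'd. eval_cpoly (P \<sigma>) (vec_of_matrix A) = 0}" for \<sigma>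
      using cert negligible_zeros_eval_cpoly_matrix[of "P \<sigma>"] by blast
    ultimately have "negligible (- G)"
      unfolding compl_G by (intro negligible_countable_Union) auto
    then show ?thesis
      by (simp add: negligible_iff_null_sets)
  qed
  have G_dense: "closure G = UNIV" if "countable \<Theta>"
  proof -
    \<comment> \<open>Non-empty open sets are not null, so full measure gives density.\<close>
    have "negligible (interior (- G))"
      using negligible_subset[OF _ interior_subset] G_null[OF that]
      by (simp add: negligible_iff_null_sets)
    then have "interior (- G) = {}"
      using open_not_negligible by blast
    then show ?thesis
      by (simp add: closure_interior)
  qed
  have "zariski_open (vec_of_matrix ` G)" if "finite \<Theta>"
  proof -
    \<comment> \<open>The finitely many certificates combine into one polynomial, their product,
      which vanishes exactly where one of them does.\<close>
    have "(\<lambda>x. \<Prod>\<sigma>\<in>\<Sigma>. eval_cpoly (P \<sigma>) x) \<in> range (eval_cpoly :: ('d \<times> 'm) cpoly \<Rightarrow> _)"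
      by (intro prod_in_range_eval_cpoly) auto
    then obtain p :: "('d \<times> 'm) cpoly" where p: "(\<lambda>x. \<Prod>\<sigma>\<in>\<Sigma>. eval_cpoly (P \<sigma>) x) = eval_cpoly p"
      by (rule rangeE)
    have "finite \<Sigma>"
      using that by (simp add: \<Sigma>_def finite_PiE)
    have "x \<in> vec_of_matrix ` G \<longleftrightarrow> (\<forall>\<sigma>\<in>\<Sigma>. eval_cpoly (P \<sigma>) x \<noteq> 0)" for x
    proof -
      \<comment> \<open>Every vector comes from a matrix, so membership in the image of
        \<open>G\<close> becomes a condition on \<open>x\<close> alone.\<close>
      have "x = vec_of_matrix (\<chi> i j. x $ (i, j))"
        by (simp add: vec_of_matrix_def vec_eq_iff)
      then show ?thesis
        by (auto simp: G_def intro: image_eqI)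
    qed
    then have "- vec_of_matrix ` G = {x. \<forall>q\<in>{p}. eval_cpoly q x = 0}"
      using \<open>finite \<Sigma>\<close> by (auto simp flip: p)
    then show ?thesis
      unfolding zariski_open_def zariski_closed_def by blast
  qed
  \<comment> \<open>This also settles the finite case: a dense set is non-empty.\<close>
  moreover have "G \<noteq> {}" if "countable \<Theta>"
    using G_dense[OF that] by auto
  moreover have "gdelta_in euclidean G" if "countable \<Theta>"
  proof -
    have "countable \<Sigma>"
      using that by (simp add: \<Sigma>_def countable_PiE)
    have "open {A :: complex ^ 'm ^ 'd. eval_cpoly (P \<sigma>) (vec_of_matrix A) \<noteq> 0}" for \<sigma>
      by (intro open_Collect_neq continuous_intros
          continuous_on_compose2[OF continuous_on_eval_cpoly continuous_on_vec_of_matrix]) auto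
    moreover have "G = (\<Inter>\<sigma>\<in>\<Sigma>. {A. eval_cpoly (P \<sigma>) (vec_of_matrix A) \<noteq> 0})"
      by (auto simp: G_def)
    ultimately show ?thesis
      using \<open>countable \<Sigma>\<close>
      by (simp only: gdelta_in_alt)
        (auto intro!: countable_intersection_of_Inter intro: countable_intersection_of_inc)
  qed
  ultimately show ?thesis
    using G_PR G_null G_dense countable_finite[of \<Theta>]
    by (intro conjI impI exI[of _ G]) simp_all
qed

end
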